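(* Let $p$ be a prime and let $G$ be a group of order $p^n$. Then $$\delta(G)\leq \sum_{k=2}^{n}\begin{bmatrix} n\\ k\end{bmatrix}_p,$$ and equality holds if and only if $G$ is an elementary abelian $p$-group of order $p^n$.
   Context: For a finite group $G$, $\delta(G)$ denotes the number of all non-cyclic subgroups of $G$ (including $G$ itself if it is non-cyclic; the trivial subgroup is cyclic). For integers $0<k\le n$, $\begin{bmatrix} n\\ k\end{bmatrix}_p=\frac{(p^n-1)(p^{n-1}-1)\cdots(p^{n-k+1}-1)}{(p^k-1)(p^{k-1}-1)\cdots(p-1)}$ is the Gaussian binomial coefficient, i.e. the number of subgroups of order $p^k$ of an elementary abelian group of order $p^n$. *)

theory Defs
  imports Complex_Main "HOL-Computational_Algebra.Primes" "HOL-Algebra.Elementary_Groups"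
begin

definition num_noncyclic_subgroups :: "('a, 'b) monoid_scheme \<Rightarrow> nat"  (\<open>\<delta>\<close>)
  where "\<delta> G = card {H. subgroup H G \<and> \<not> cyclic_group (G\<lparr>carrier := H\<rparr>)}"

(* A real quotient, so that no divisibility is needed; meant for 0 < k \<le> n and q > 1. *)
definition gauss_binomial :: "nat \<Rightarrow> nat \<Rightarrow> nat \<Rightarrow> real"
  where "gauss_binomial q n k =
    (\<Prod>i<k. real q ^ (n - i) - 1) / (\<Prod>i<k. real q ^ (k - i) - 1)"

definition elementary_abelian_group :: "nat \<Rightarrow> ('a, 'b) monoid_scheme \<Rightarrow> bool"
  where "elementary_abelian_group p G \<longleftrightarrow>
    comm_group G \<and> (\<forall>x \<in> carrier G. x [^]\<^bsub>G\<^esub> p = \<one>\<^bsub>G\<^esub>)"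

end

theory Submission
  imports Defs "HOL-Algebra.Multiplicative_Group" "HOL-Algebra.Sylow" "HOL-Algebra.Group_Action"
begin

text \<open>
  A noncyclic subgroup of \<open>G\<close> has order \<open>p ^ k\<close> with \<open>2 \<le> k \<le> n\<close>, because groups of order \<open>1\<close> and
  \<open>p\<close> are cyclic. The inequality therefore follows if, for every \<open>k\<close>, the number \<open>s\<^sub>k(G)\<close> of all
  subgroups of order \<open>p ^ k\<close> is at most \<open>gauss_binomial p n k\<close> (\<open>card_subgroups_of_order\<close>).

  This bound is an induction on \<open>n\<close> along the \<open>q\<close>-Pascal rule. By Sylow's theorem there is a
  subgroup \<open>M\<close> of index \<open>p\<close>. The subgroups of order \<open>p ^ (k + 1)\<close> inside \<open>M\<close> are counted by
  \<open>s\<^sub>k\<^sub>+\<^sub>1(M)\<close>. A subgroup \<open>H\<close> of that order not inside \<open>M\<close> meets \<open>M\<close> in a subgroup of order \<open>p ^ k\<close>,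
  and it is generated by this intersection together with any of its elements outside \<open>M\<close>. So the
  pairs \<open>(H, x)\<close> with \<open>x \<in> H - M\<close> embed into the pairs \<open>(L, x)\<close> with \<open>L\<close> a subgroup of \<open>M\<close> of order
  \<open>p ^ k\<close> and \<open>x \<in> G - M\<close>. Counting both sides gives
  \<open>s\<^sub>k\<^sub>+\<^sub>1(G) \<le> s\<^sub>k\<^sub>+\<^sub>1(M) + p ^ (n - k - 1) * s\<^sub>k(M)\<close>. If \<open>G\<close> is elementary abelian, every \<open>(L, x)\<close> comes from
  a subgroup, namely \<open>L\<langle>x\<rangle>\<close>, and the induction yields equality; moreover all subgroups of order at
  least \<open>p ^ 2\<close> are then noncyclic, so the number of noncyclic subgroups attains the bound.

  For the converse only the subgroups of order \<open>p ^ 2\<close> matter. Equality of the sums forces equality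
  for \<open>k = 2\<close>. Every noncyclic subgroup of order \<open>p ^ 2\<close> contains exactly \<open>(p ^ 2 - 1) * (p ^ 2 - p)\<close>
  pairs \<open>(x, y)\<close> with \<open>x \<noteq> \<one>\<close> and \<open>y \<notin> \<langle>x\<rangle>\<close>, and each such pair determines the subgroup. As \<open>G\<close>
  itself has at most \<open>(p ^ n - 1) * (p ^ n - p)\<close> such pairs, with equality only if all nontrivial
  elements have order \<open>p\<close>, equality for \<open>k = 2\<close> means that \<open>G\<close> has exponent \<open>p\<close> and that any two of
  its elements lie in a common subgroup of order dividing \<open>p ^ 2\<close>, which is commutative
  (\<open>elementary_abelian_if_many_noncyclic_subgroups\<close>).
\<close>

section \<open>The Pascal rule for Gaussian binomials\<close>

lemma gauss_binomial_0 [simp]: "gauss_binomial q n 0 = 1"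
  by (simp add: gauss_binomial_def)

text \<open>The factor of the numerator with index \<open>n\<close> is \<open>q ^ 0 - 1\<close>.\<close>
lemma gauss_binomial_eq_0: "n < k \<Longrightarrow> gauss_binomial q n k = 0"
  unfolding gauss_binomial_def by (auto intro!: bexI[of _ n])

text \<open>
  Over the common denominator, the rule reduces to the identity
  \<open>q ^ (n + 1) - 1 = (q ^ (n - k) - 1) + q ^ (n - k) * (q ^ (k + 1) - 1)\<close>. Of the two Pascal rules this
  is the one that matches the split of the subgroups by a subgroup of index \<open>p\<close>.
\<close>
lemma gauss_binomial_Suc:
  assumes "q > 1" "k \<le> n"
  shows "gauss_binomial q (Suc n) (Suc k)
    = gauss_binomial q n (Suc k) + real q ^ (n - k) * gauss_binomial q n k"
proof -
  define N where "N = (\<Prod>i<k. real q ^ (n - i) - 1)"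
  define D where "D = (\<Prod>i<k. real q ^ (k - i) - 1)"
  have q: "real q > 1" using assms by simp
  have D: "D \<noteq> 0" unfolding D_def
  proof (clarsimp simp: prod_zero_iff)
    fix i assume "i < k" "real q ^ (k - i) = 1"
    then show False using one_less_power[OF q, of "k - i"] by simp
  qed
  have q': "real q ^ Suc k - 1 \<noteq> 0"
    using q by (smt (verit) one_less_power zero_less_Suc)
  have 1: "gauss_binomial q n k = N / D"
    by (simp add: gauss_binomial_def N_def D_def)
  have D': "(\<Prod>i<Suc k. real q ^ (Suc k - i) - 1) = (real q ^ Suc k - 1) * D"
    unfolding prod.lessThan_Suc_shift D_def by simp
  have 2: "gauss_binomial q n (Suc k) = (real q ^ (n - k) - 1) * N / ((real q ^ Suc k - 1) * D)"
    unfolding gauss_binomial_def D' by (simp add: N_def mult.commute)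
  have 3: "gauss_binomial q (Suc n) (Suc k) = (real q ^ Suc n - 1) * N / ((real q ^ Suc k - 1) * D)"
    unfolding gauss_binomial_def D' unfolding prod.lessThan_Suc_shift N_def by simp
  have "real q ^ Suc n = real q ^ (n - k) * real q ^ Suc k"
    using assms by (simp flip: power_add)
  then have "real q ^ Suc n - 1 = (real q ^ (n - k) - 1) + real q ^ (n - k) * (real q ^ Suc k - 1)"
    by (simp add: algebra_simps)
  moreover have "N / D = (real q ^ Suc k - 1) * N / ((real q ^ Suc k - 1) * D)"
    using q' by simp
  ultimately show ?thesis
    unfolding 1 2 3 by (simp only: distrib_right add_divide_distrib times_divide_eq_right mult.assoc)
qed

section \<open>Subgroups of finite p-groups and a subgroup of index p\<close>

text \<open>
  If \<open>a \<otimes> b = a' \<otimes> b'\<close>, then \<open>inv a \<otimes> a' = b \<otimes> inv b'\<close> lies in both subgroups. So the pairs with a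
  given product are determined, once one of them is chosen, by an element of \<open>A \<inter> B\<close>.
\<close>
lemma (in group) card_times_le_set_mult:
  assumes "subgroup A G" "subgroup B G" "finite (carrier G)"
  shows "card A * card B \<le> card (A <#> B) * card (A \<inter> B)"
proof -
  interpret A: subgroup A G by fact
  interpret B: subgroup B G by fact
  have fin: "finite A" "finite B"
    using assms(3) A.subset B.subset by (auto intro: finite_subset)
  let ?f = "\<lambda>(a, b). a \<otimes> b"
  have img: "?f ` (A \<times> B) = A <#> B"
    by (auto simp: set_mult_def)
  have fibre: "card {z \<in> A \<times> B. ?f z = y} \<le> card (A \<inter> B)" if y: "y \<in> A <#> B" for y
  proof -
    obtain a b where ab: "a \<in> A" "b \<in> B" "y = a \<otimes> b"
      using y unfolding set_mult_def by blast
    have "inv a \<otimes> a' \<in> A \<inter> B" if "a' \<in> A" "b' \<in> B" "a' \<otimes> b' = a \<otimes> b" for a' b'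
    proof -
      have c: "a \<in> carrier G" "b \<in> carrier G" "a' \<in> carrier G" "b' \<in> carrier G"
        using ab that by auto
      have "inv a \<otimes> a' = inv a \<otimes> (a' \<otimes> b') \<otimes> inv b'"
        using c by (simp add: m_assoc)
      also have "\<dots> = inv a \<otimes> a \<otimes> (b \<otimes> inv b')"
        unfolding that(3) using c by (simp only: m_assoc m_closed inv_closed)
      also have "\<dots> = b \<otimes> inv b'"
        using c by simp
      finally have "inv a \<otimes> a' \<in> B" using ab that by simp
      then show ?thesis using ab that by simp
    qed
    then have "(\<lambda>(a', b'). inv a \<otimes> a') ` {z \<in> A \<times> B. ?f z = y} \<subseteq> A \<inter> B"
      using ab by auto
    moreover have "inj_on (\<lambda>(a', b'). inv a \<otimes> a') {z \<in> A \<times> B. ?f z = y}"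
    proof (rule inj_onI)
      fix u v
      assume u: "u \<in> {z \<in> A \<times> B. ?f z = y}" and v: "v \<in> {z \<in> A \<times> B. ?f z = y}"
        and eq: "(\<lambda>(a', b'). inv a \<otimes> a') u = (\<lambda>(a', b'). inv a \<otimes> a') v"
      then have "fst u = fst v" using ab by (auto simp: Units_eq)
      moreover from this have "fst u \<otimes> snd u = fst u \<otimes> snd v"
        using u v by auto
      then have "snd u = snd v" using u v by (auto simp: Units_eq)
      ultimately show "u = v" by (simp add: prod_eq_iff)
    qed
    moreover have "finite (A \<inter> B)" using fin by simp
    ultimately show ?thesis
      using card_inj_on_le by blast
  qed
  have "card A * card B = (\<Sum>z\<in>A \<times> B. 1)"
    by (simp add: card_cartesian_product)
  also have "\<dots> = (\<Sum>y\<in>A <#> B. \<Sum>z | z \<in> A \<times> B \<and> ?f z = y. 1)"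
    unfolding img[symmetric] using fin by (intro sum.image_gen) auto
  also have "\<dots> \<le> (\<Sum>y\<in>A <#> B. card (A \<inter> B))"
    using fibre by (intro sum_mono) simp
  finally show ?thesis by simp
qed

definition subgroups_of_order :: "('a, 'b) monoid_scheme \<Rightarrow> nat \<Rightarrow> 'a set set"
  where "subgroups_of_order G m = {H. subgroup H G \<and> card H = m}"

locale finite_p_group = group G for G (structure) +
  fixes p n :: nat
  assumes prime_p: "Factorial_Ring.prime p" and order_eq: "order G = p ^ n"
begin

lemma p_gt_1: "p > 1"
  using prime_p prime_gt_1_nat by blast

lemma finite_carrier: "finite (carrier G)"
  using order_eq p_gt_1 by (metis order_gt_0_iff_finite zero_less_power less_trans zero_less_one)

lemma finite_subgroup: "subgroup H G \<Longrightarrow> finite H"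
  using finite_carrier finite_subset subgroup.subset by metis

lemma finite_subgroups_of_order: "finite (subgroups_of_order G m)"
  by (rule finite_subset[of _ "Pow (carrier G)"])
     (auto simp: subgroups_of_order_def finite_carrier dest: subgroup.subset)

lemma card_subgroup:
  assumes "subgroup H G"
  obtains k where "k \<le> n" "card H = p ^ k"
  using assms prime_p order_eq lagrange[of H] by (metis divides_primepow_nat dvd_triv_right)

text \<open>
  The product set \<open>H <#> M\<close> fits into \<open>G\<close>, so \<open>H \<inter> M\<close> has index at most \<open>p\<close> in \<open>H\<close>; it is a proper
  subgroup of \<open>H\<close>, so the index is exactly \<open>p\<close>.
\<close>
lemma card_Int_maximal:
  assumes M: "subgroup M G" "p * card M = order G"
    and H: "subgroup H G" "card H = p ^ Suc k" "\<not> H \<subseteq> M"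
  shows "card (H \<inter> M) = p ^ k"
proof -
  have "H <#> M \<subseteq> carrier G"
    using M H by (meson set_mult_closed subgroup.subset)
  then have "card (H <#> M) \<le> p * card M"
    using M finite_carrier by (metis card_mono order_def)
  then have "card H * card M \<le> p * card M * card (H \<inter> M)"
    using card_times_le_set_mult[OF H(1) M(1) finite_carrier] by (meson le_trans mult_le_mono1)
  moreover have "card M > 0"
    using M finite_carrier subgroup.finite_imp_card_positive by blast
  ultimately have *: "card H \<le> p * card (H \<inter> M)"
    by (simp add: mult.assoc mult.left_commute)
  obtain j where j: "card (H \<inter> M) = p ^ j"
    using card_subgroup M H subgroups_Inter_pair by metis
  have "p ^ Suc k \<le> p ^ Suc j"
    using * H(2) j by simp
  then have "k \<le> j" using p_gt_1 power_increasing_iff by blast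
  moreover have "H \<inter> M \<subset> H" using H(3) by blast
  then have "card (H \<inter> M) < card H"
    using finite_subgroup[OF H(1)] psubset_card_mono by blast
  then have "j < Suc k"
    unfolding j H(2) using p_gt_1 power_strict_increasing_iff by blast
  ultimately show ?thesis using j le_antisym less_Suc_eq_le by metis
qed

text \<open>
  The intersection \<open>H \<inter> K\<close> is strictly larger than the index-\<open>p\<close> subgroup \<open>L\<close>, so its order is
  already \<open>p ^ (k + 1)\<close>. This makes the counts of pairs below injective.
\<close>
lemma subgroup_determined_by_maximal:
  assumes H: "subgroup H G" "card H = p ^ Suc k" and K: "subgroup K G" "card K = p ^ Suc k"
    and L: "L \<subseteq> H \<inter> K" "card L = p ^ k" and x: "x \<in> H \<inter> K" "x \<notin> L"
  shows "H = K"
proof -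
  obtain j where j: "card (H \<inter> K) = p ^ j"
    using card_subgroup H(1) K(1) subgroups_Inter_pair by metis
  have "L \<subset> H \<inter> K" using L x by blast
  then have "p ^ k < p ^ j"
    using finite_subgroup H(1) L(2) j by (metis finite_Int psubset_card_mono)
  then have "k < j" using p_gt_1 power_strict_increasing_iff by blast
  then have "p ^ Suc k \<le> card (H \<inter> K)"
    unfolding j using p_gt_1 by (intro power_increasing) auto
  then have "H \<inter> K = H" "H \<inter> K = K"
    using H K finite_subgroup by (metis card_seteq inf_le1 inf_le2)+
  then show ?thesis by simp
qed

text \<open>
  The subgroup is \<open>L <#> generate G {x}\<close>. Commutativity makes it a subgroup, and exponent \<open>p\<close> bounds
  its order by \<open>p ^ (k + 1)\<close>.
\<close>
lemma elementary_abelian_extend_subgroup: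
  assumes ea: "elementary_abelian_group p G"
    and L: "subgroup L G" "card L = p ^ k" and x: "x \<in> carrier G" "x \<notin> L"
  obtains H where "subgroup H G" "card H = p ^ Suc k" "L \<subseteq> H" "x \<in> H"
proof -
  interpret comm_group G using ea by (simp add: elementary_abelian_group_def)
  let ?X = "generate G {x}"
  define H where "H = L <#> ?X"
  have X: "subgroup ?X G" using x by (simp add: generate_is_subgroup)
  have H: "subgroup H G" unfolding H_def using mult_subgroups L(1) X by blast
  have mem: "l \<otimes> y \<in> H" if "l \<in> L" "y \<in> ?X" for l y
    using that by (auto simp: H_def set_mult_def)
  have LH: "L \<subseteq> H"
    using mem[OF _ subgroup.one_closed[OF X]] subgroup.mem_carrier[OF L(1)] by fastforce
  have xH: "x \<in> H"
    using mem[OF subgroup.one_closed[OF L(1)] generate.incl[of x "{x}" G]] x(1) by simp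
  have "ord x dvd p" using ea x(1) by (simp add: elementary_abelian_group_def pow_eq_id)
  then have "ord x \<le> p" using p_gt_1 by (intro dvd_imp_le) auto
  then have cX: "card ?X \<le> p" using x(1) generate_pow_card by simp
  have "H = (\<lambda>(a, b). a \<otimes> b) ` (L \<times> ?X)"
    by (auto simp: H_def set_mult_def)
  then have "card H \<le> card L * card ?X"
    using finite_subgroup[OF L(1)] finite_subgroup[OF X]
    by (metis card_cartesian_product card_image_le finite_SigmaI)
  also have "\<dots> \<le> p ^ Suc k"
    using L(2) cX by simp
  finally have le: "card H \<le> p ^ Suc k" .
  obtain j where j: "card H = p ^ j"
    using card_subgroup[OF H] by metis
  have "L \<subset> H" using LH xH x(2) by blast
  then have "p ^ k < p ^ j"
    using j L(2) finite_subgroup[OF H] by (metis psubset_card_mono)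
  then have "k < j" using p_gt_1 power_strict_increasing_iff by blast
  then have "p ^ Suc k \<le> card H"
    unfolding j using p_gt_1 by (intro power_increasing) auto
  with le have "card H = p ^ Suc k" by simp
  then show ?thesis using H LH xH that by blast
qed

text \<open>
  The pairs \<open>(H, x)\<close> with \<open>H \<in> A\<close> and \<open>x \<in> H - M\<close> are compared with the pairs \<open>(L, x)\<close> with \<open>L \<in> B\<close>
  and \<open>x \<in> G - M\<close> by means of \<open>(H, x) \<mapsto> (H \<inter> M, x)\<close>. There are \<open>p ^ (k + 1) - p ^ k\<close> choices of \<open>x\<close>
  for each \<open>H\<close> and \<open>p ^ n - p ^ (n - 1)\<close> choices for each \<open>L\<close>, whose quotient is the factor
  \<open>p ^ (n - k - 1)\<close>.
\<close>
lemma card_subgroups_outside_maximal: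
  fixes M k
  assumes M: "subgroup M G" "p * card M = order G" and k: "k < n"
  defines "A \<equiv> {H \<in> subgroups_of_order G (p ^ Suc k). \<not> H \<subseteq> M}"
    and "B \<equiv> {L \<in> subgroups_of_order G (p ^ k). L \<subseteq> M}"
  shows "card A \<le> p ^ (n - Suc k) * card B"
    and "elementary_abelian_group p G \<Longrightarrow> card A = p ^ (n - Suc k) * card B"
proof -
  have finA: "finite A" and finB: "finite B"
    using finite_subgroups_of_order by (simp_all add: A_def B_def)
  have AD: "subgroup H G" "card H = p ^ Suc k" "\<not> H \<subseteq> M" "finite H" if "H \<in> A" for H
    using that finite_subgroup by (auto simp: A_def subgroups_of_order_def)
  define S where "S = (SIGMA H:A. H - M)"
  define T where "T = B \<times> (carrier G - M)"
  define f where "f = (\<lambda>(H, x :: 'a). (H \<inter> M, x))"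
  have cInt: "card (H \<inter> M) = p ^ k" if "H \<in> A" for H
    using card_Int_maximal[OF M] AD[OF that] by blast
  have int: "H \<inter> M \<in> B" if "H \<in> A" for H
    using cInt[OF that] subgroups_Inter_pair[OF AD(1)[OF that] M(1)]
    by (simp add: B_def subgroups_of_order_def)
  have finT: "finite T" using finB finite_carrier by (simp add: T_def)
  have sub: "f ` S \<subseteq> T"
    using int AD(1) unfolding f_def S_def T_def by (auto dest: subgroup.mem_carrier)
  have inj: "inj_on f S"
  proof (rule inj_onI)
    fix u v assume uv: "u \<in> S" "v \<in> S" "f u = f v"
    obtain H x K where u: "u = (H, x)" and v: "v = (K, x)" and eq: "H \<inter> M = K \<inter> M"
      using uv(3) by (cases u, cases v) (auto simp: f_def)
    have HK: "H \<in> A" "K \<in> A" "x \<in> H" "x \<in> K" "x \<notin> M"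
      using uv u v by (auto simp: S_def)
    have "H = K"
      by (rule subgroup_determined_by_maximal[where L = "H \<inter> M" and x = x])
        (use AD[OF HK(1)] AD[OF HK(2)] cInt[OF HK(1)] HK eq in auto)
    then show "u = v" by (simp add: u v)
  qed
  have "card (H - M) = p ^ k * (p - 1)" if "H \<in> A" for H
  proof -
    have "card (H - M) = card H - card (H \<inter> M)"
      using AD(4)[OF that] by (simp add: card_Diff_subset_Int)
    then show ?thesis
      using AD(2)[OF that] cInt[OF that] by (simp add: algebra_simps)
  qed
  then have cardS: "card S = card A * (p ^ k * (p - 1))"
    unfolding S_def using finA AD(4) by (subst card_SigmaI) auto
  have cardT: "card T = p ^ (n - Suc k) * card B * (p ^ k * (p - 1))"
  proof -
    have "card (carrier G - M) = p * card M - card M"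
      unfolding M(2) order_def
      by (rule card_Diff_subset) (use M(1) finite_subgroup in \<open>auto dest: subgroup.subset\<close>)
    moreover have "p * card M = p * (p ^ (n - Suc k) * p ^ k)"
      using M(2) order_eq k by (simp flip: power_add power_Suc)
    then have "card M = p ^ (n - Suc k) * p ^ k"
      using p_gt_1 by simp
    ultimately show ?thesis by (simp add: T_def card_cartesian_product algebra_simps)
  qed
  have pos: "p ^ k * (p - 1) > 0" using p_gt_1 by simp
  have "card S \<le> card T" using card_inj_on_le[OF inj sub finT] .
  then show "card A \<le> p ^ (n - Suc k) * card B"
    unfolding cardS cardT using pos by (metis mult_le_cancel2)
  assume ea: "elementary_abelian_group p G"
  have "T \<subseteq> f ` S"
  proof
    fix t assume "t \<in> T"
    then obtain L x where t: "t = (L, x)" "L \<in> B" "x \<in> carrier G" "x \<notin> M"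
      by (auto simp: T_def)
    have L: "subgroup L G" "card L = p ^ k" "L \<subseteq> M"
      using t(2) by (auto simp: B_def subgroups_of_order_def)
    obtain H where H: "subgroup H G" "card H = p ^ Suc k" "L \<subseteq> H" "x \<in> H"
      using elementary_abelian_extend_subgroup[OF ea L(1,2) t(3)] t(4) L(3) by blast
    have HA: "H \<in> A" using H t by (auto simp: A_def subgroups_of_order_def)
    have "L = H \<inter> M" using L H(3) cInt[OF HA] AD(4)[OF HA] by (intro card_subset_eq) auto
    then have "t = f (H, x)" "(H, x) \<in> S" using HA H t by (auto simp: f_def S_def)
    then show "t \<in> f ` S" by blast
  qed
  then have "card T = card S" using sub inj by (metis card_image subset_antisym)
  then show "card A = p ^ (n - Suc k) * card B"
    unfolding cardS cardT using pos by simp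
qed

text \<open>
  Subgroups of index \<open>p\<close> are normal. If a conjugate \<open>K = g M g\<inverse>\<close> differs from \<open>M\<close>, then \<open>K \<inter> M\<close> has
  index \<open>p\<close> in \<open>M\<close>, hence \<open>M K\<close> is all of \<open>G\<close>. Writing \<open>g\<inverse> = a (g b g\<inverse>)\<close> with \<open>a, b \<in> M\<close> gives
  \<open>a g b = \<one>\<close>, so that \<open>g \<in> M\<close> and \<open>K = M\<close> after all.
\<close>
lemma maximal_subgroup_conjugate_closed:
  assumes M: "subgroup M G" "p * card M = order G" and g: "g \<in> carrier G" and m: "m \<in> M"
  shows "g \<otimes> m \<otimes> inv g \<in> M"
proof (rule ccontr)
  assume out: "g \<otimes> m \<otimes> inv g \<notin> M"
  define K where "K = g <# M #> inv g"
  have K_eq: "K = (\<lambda>h. g \<otimes> h \<otimes> inv g) ` M"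
    by (auto simp: K_def l_coset_def r_coset_def)
  have K: "subgroup K G"
    unfolding K_def using subgroup_conjugation_is_surj2 g M(1) by blast
  have MG: "h \<in> carrier G" if "h \<in> M" for h
    using subgroup.mem_carrier[OF M(1) that] .
  have "inj_on (\<lambda>h. g \<otimes> h \<otimes> inv g) M"
    using conjugation_is_inj[OF g] MG by (intro inj_onI) blast
  then have cK: "card K = card M"
    unfolding K_eq by (rule card_image)
  obtain j where j: "card M = p ^ j" using card_subgroup[OF M(1)] by metis
  have "M \<noteq> {\<one>}" using out m g by auto
  then have "card M \<noteq> 1"
    using subgroup.one_closed[OF M(1)] by (metis card_1_singletonE singletonD)
  then obtain k where k: "j = Suc k" using j by (cases j) auto
  have "\<not> K \<subseteq> M" using out m unfolding K_eq by blast
  then have int: "card (K \<inter> M) = p ^ k"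
    using card_Int_maximal[OF M K] cK j k by simp
  have "p ^ Suc k * card M \<le> p ^ k * card (M <#> K)"
    using card_times_le_set_mult[OF M(1) K finite_carrier] int cK j k
    by (simp add: Int_commute mult.commute)
  then have "order G \<le> card (M <#> K)"
    using M(2) p_gt_1 by (simp add: mult.assoc)
  moreover have "M <#> K \<subseteq> carrier G"
    using set_mult_closed subgroup.subset M(1) K by metis
  ultimately have "M <#> K = carrier G"
    using card_seteq[OF finite_carrier] by (simp add: order_def)
  then have "inv g \<in> M <#> K" using g by simp
  then obtain a b where ab: "a \<in> M" "b \<in> M" "inv g = a \<otimes> (g \<otimes> b \<otimes> inv g)"
    unfolding set_mult_def K_eq by blast
  have c: "a \<in> carrier G" "b \<in> carrier G" using ab MG by auto
  have "inv g = (a \<otimes> g \<otimes> b) \<otimes> inv g"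
    using ab(3) c g by (simp add: m_assoc)
  then have "a \<otimes> (g \<otimes> b) = \<one>"
    using c g r_cancel_one[of "inv g" "a \<otimes> g \<otimes> b"] by (simp add: m_assoc)
  then have "g \<otimes> b = inv a"
    using c g by (metis inv_equality inv_inv m_closed)
  then have "g = inv a \<otimes> inv b" using c g by (metis inv_solve_right inv_closed)
  then have "g \<in> M"
    using ab M(1) by (simp add: subgroup.m_closed subgroup.m_inv_closed)
  then show False using out m M(1) by (simp add: subgroup.m_closed subgroup.m_inv_closed)
qed

text \<open>
  The cyclic groups of \<open>x\<close> and \<open>y\<close> are normal, having index \<open>p\<close>, and they meet trivially. The
  commutator of \<open>x\<close> and \<open>y\<close> lies in both of them.
\<close>
lemma commute_in_order_p_squared:
  assumes n: "n = 2" and xy: "x \<in> carrier G" "y \<in> carrier G"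
    and X: "card (generate G {x}) = p" and Y: "card (generate G {y}) = p"
    and out: "y \<notin> generate G {x}"
  shows "x \<otimes> y = y \<otimes> x"
proof -
  let ?X = "generate G {x}" and ?Y = "generate G {y}"
  have sX: "subgroup ?X G" and sY: "subgroup ?Y G"
    using xy by (simp_all add: generate_is_subgroup)
  have mX: "p * card ?X = order G" and mY: "p * card ?Y = order G"
    using X Y n order_eq by (simp_all add: power2_eq_square)
  have x: "x \<in> ?X" and y: "y \<in> ?Y" by (simp_all add: generate.incl)
  have "\<not> ?Y \<subseteq> ?X" using y out by blast
  then have "card (?Y \<inter> ?X) = 1"
    using card_Int_maximal[OF sX mX sY, of 0] Y by simp
  then have triv: "?Y \<inter> ?X = {\<one>}"
    using subgroup.one_closed[OF sX] subgroup.one_closed[OF sY]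
    by (metis IntI card_1_singletonE singletonD)
  have "x \<otimes> (y \<otimes> inv x \<otimes> inv y) \<in> ?X"
    using maximal_subgroup_conjugate_closed[OF sX mX xy(2)] x sX
    by (simp add: subgroup.m_closed subgroup.m_inv_closed)
  moreover have "x \<otimes> y \<otimes> inv x \<otimes> inv y \<in> ?Y"
    using maximal_subgroup_conjugate_closed[OF sY mY xy(1)] y sY
    by (simp add: subgroup.m_closed subgroup.m_inv_closed)
  ultimately have "x \<otimes> y \<otimes> (inv x \<otimes> inv y) = \<one>"
    using triv xy by (auto simp: m_assoc)
  then have "x \<otimes> y = inv (inv x \<otimes> inv y)"
    using xy inv_equality[of "x \<otimes> y" "inv x \<otimes> inv y"] by simp
  then show ?thesis using xy by (simp add: inv_mult_group)
qed

end

section \<open>Counting all subgroups of a given order\<close>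

lemma (in group) subgroups_of_order_restrict:
  assumes "subgroup M G"
  shows "subgroups_of_order (G\<lparr>carrier := M\<rparr>) m = {L \<in> subgroups_of_order G m. L \<subseteq> M}"
proof -
  have "subgroup L (G\<lparr>carrier := M\<rparr>) \<longleftrightarrow> subgroup L G \<and> L \<subseteq> M" for L
    using incl_subgroup[OF assms] subgroup_incl[OF _ assms]
      subgroup.subset[of L "G\<lparr>carrier := M\<rparr>"] by auto
  then show ?thesis by (simp add: subgroups_of_order_def conj_ac)
qed

lemma (in group) elementary_abelian_subgroup:
  assumes "elementary_abelian_group p G" "subgroup M G"
  shows "elementary_abelian_group p (G\<lparr>carrier := M\<rparr>)"
proof -
  interpret comm_group G using assms(1) by (simp add: elementary_abelian_group_def)
  have MG: "x \<in> carrier G" if "x \<in> M" for x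
    using subgroup.mem_carrier[OF assms(2) that] .
  have "comm_group (G\<lparr>carrier := M\<rparr>)"
    using MG by (intro group.group_comm_groupI subgroup_imp_group assms(2)) (auto intro: m_comm)
  then show ?thesis
    using assms(1) MG by (auto simp: elementary_abelian_group_def simp flip: nat_pow_consistent)
qed

lemma (in finite_p_group) subgroup_finite_p_group:
  assumes "subgroup H G" "card H = p ^ m"
  shows "finite_p_group (G\<lparr>carrier := H\<rparr>) p m"
  using assms prime_p subgroup_imp_group
  by (simp add: finite_p_group_def finite_p_group_axioms_def order_def)

lemma (in group) subgroups_of_order_1:
  "subgroups_of_order G 1 = {{\<one>}}"
proof -
  have "subgroup H G \<and> card H = 1 \<longleftrightarrow> H = {\<one>}" for H
  proof
    assume "subgroup H G \<and> card H = 1"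
    then show "H = {\<one>}"
      using subgroup.one_closed by (metis card_1_singletonE singletonD)
  qed (use triv_subgroup in simp)
  then show ?thesis by (simp add: subgroups_of_order_def)
qed

lemma (in finite_p_group) subgroups_of_order_empty:
  assumes "n < k"
  shows "subgroups_of_order G (p ^ k) = {}"
proof -
  have False if H: "subgroup H G" "card H = p ^ k" for H
  proof -
    obtain j where "j \<le> n" "card H = p ^ j" using card_subgroup[OF H(1)] .
    then show False using H(2) assms p_gt_1 power_inject_exp[of p j k] by simp
  qed
  then show ?thesis by (auto simp: subgroups_of_order_def)
qed

text \<open>
  The induction step adds the subgroups inside and outside a subgroup of index \<open>p\<close>. Both estimates
  are equalities for an elementary abelian group, and this property passes to subgroups, so the
  bound and its sharpness are carried through the same induction.
\<close>
lemma card_subgroups_of_order: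
  assumes "finite_p_group G p n"
  shows "real (card (subgroups_of_order G (p ^ k))) \<le> gauss_binomial p n k
    \<and> (elementary_abelian_group p G \<longrightarrow>
        real (card (subgroups_of_order G (p ^ k))) = gauss_binomial p n k)"
  using assms
proof (induction n arbitrary: G k)
  case (0 G k)
  then interpret finite_p_group G p 0 .
  show ?case
  proof (cases "k = 0")
    case True
    then show ?thesis by (simp only: power_0 subgroups_of_order_1) simp
  next
    case False
    then have "subgroups_of_order G (p ^ k) = {}" by (intro subgroups_of_order_empty) simp
    then show ?thesis using False by (simp add: gauss_binomial_eq_0)
  qed
next
  case (Suc n G k)
  then interpret finite_p_group G p "Suc n" by simp
  consider "k = 0" | "Suc n < k" | k' where "k = Suc k'" "k' \<le> n"
    by (metis Suc_le_mono not0_implies_Suc not_le)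
  then show ?case
  proof cases
    case 1
    then show ?thesis using subgroups_of_order_1 by simp
  next
    case 2
    then show ?thesis using subgroups_of_order_empty by (simp add: gauss_binomial_eq_0)
  next
    case (3 k')
    obtain M where M: "subgroup M G" "card M = p ^ n"
      using sylow_thm[OF prime_p group_axioms _ finite_carrier, of n p] order_eq by auto
    have mM: "p * card M = order G" using M order_eq by simp
    let ?M = "G\<lparr>carrier := M\<rparr>"
    let ?sub = "\<lambda>G k. subgroups_of_order G (p ^ k)"
    have IH: "real (card (?sub ?M i)) \<le> gauss_binomial p n i"
      "elementary_abelian_group p G \<Longrightarrow> real (card (?sub ?M i)) = gauss_binomial p n i" for i
      using Suc.IH[of ?M i] subgroup_finite_p_group[OF M] elementary_abelian_subgroup[OF _ M(1)]
      by auto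
    have "?sub G k = ?sub ?M k \<union> {H \<in> ?sub G k. \<not> H \<subseteq> M}"
      using subgroups_of_order_restrict[OF M(1)] by auto
    then have split: "card (?sub G k) = card (?sub ?M k) + card {H \<in> ?sub G k. \<not> H \<subseteq> M}"
      using finite_subgroups_of_order subgroups_of_order_restrict[OF M(1)]
      by (subst card_Un_disjoint[symmetric]) auto
    have outside:
      "card {H \<in> ?sub G k. \<not> H \<subseteq> M} \<le> p ^ (n - k') * card (?sub ?M k')"
      "elementary_abelian_group p G \<Longrightarrow>
        card {H \<in> ?sub G k. \<not> H \<subseteq> M} = p ^ (n - k') * card (?sub ?M k')"
      using card_subgroups_outside_maximal[OF M(1) mM, of k'] 3
        subgroups_of_order_restrict[OF M(1)] by simp_all
    have pascal: "gauss_binomial p (Suc n) k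
        = gauss_binomial p n k + real p ^ (n - k') * gauss_binomial p n k'"
      using gauss_binomial_Suc[OF p_gt_1 3(2)] 3(1) by simp
    have "real (card {H \<in> ?sub G k. \<not> H \<subseteq> M}) \<le> real p ^ (n - k') * gauss_binomial p n k'"
    proof -
      have "real (card {H \<in> ?sub G k. \<not> H \<subseteq> M}) \<le> real (p ^ (n - k') * card (?sub ?M k'))"
        using outside(1) of_nat_le_iff by blast
      also have "\<dots> \<le> real p ^ (n - k') * gauss_binomial p n k'"
        using IH(1)[of k'] by (simp add: mult_left_mono)
      finally show ?thesis .
    qed
    then have "real (card (?sub G k)) \<le> gauss_binomial p (Suc n) k"
      using split pascal IH(1)[of k] by simp
    moreover have "real (card (?sub G k)) = gauss_binomial p (Suc n) k"
      if ea: "elementary_abelian_group p G"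
      using split pascal IH(2)[OF ea] outside(2)[OF ea] by simp
    ultimately show ?thesis by blast
  qed
qed

section \<open>Noncyclic subgroups\<close>

lemma (in group) cyclic_group_iff_generate:
  "cyclic_group G \<longleftrightarrow> (\<exists>x\<in>carrier G. carrier G = generate G {x})"
  unfolding cyclic_group
  by (rule bex_cong[OF refl]) (simp only: generate_pow Setcompr_eq_image)

lemma (in group) cyclic_subgroup_iff:
  assumes "subgroup H G"
  shows "cyclic_group (G\<lparr>carrier := H\<rparr>) \<longleftrightarrow> (\<exists>x\<in>H. H = generate G {x})"
proof -
  have carrier_eq: "carrier (G\<lparr>carrier := H\<rparr>) = H" by simp
  have "cyclic_group (G\<lparr>carrier := H\<rparr>) \<longleftrightarrow> (\<exists>x\<in>H. H = generate (G\<lparr>carrier := H\<rparr>) {x})"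
    using group.cyclic_group_iff_generate[OF subgroup_imp_group[OF assms]] unfolding carrier_eq .
  also have "\<dots> \<longleftrightarrow> (\<exists>x\<in>H. H = generate G {x})"
    by (rule bex_cong[OF refl]) (simp only: generate_consistent[OF _ assms] insert_subset empty_subsetI)
  finally show ?thesis .
qed

context finite_p_group
begin

definition noncyclic_subgroups :: "nat \<Rightarrow> 'a set set"
  where "noncyclic_subgroups m =
    {H \<in> subgroups_of_order G m. \<not> cyclic_group (G\<lparr>carrier := H\<rparr>)}"

lemma card_generate_ge:
  assumes "x \<in> carrier G" "x \<noteq> \<one>"
  shows "p \<le> card (generate G {x})"
proof -
  have sub: "subgroup (generate G {x}) G" using assms by (simp add: generate_is_subgroup)
  obtain j where j: "card (generate G {x}) = p ^ j" using card_subgroup[OF sub] by metis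
  have "card (generate G {x}) \<noteq> 1"
    using assms generate_pow_card ord_eq_1 by metis
  then have "j \<noteq> 0" using j by (metis power_0)
  then show ?thesis using j p_gt_1 self_le_power[of p j] by simp
qed

lemma cyclic_of_order_le_p:
  assumes H: "subgroup H G" "card H \<le> p"
  shows "cyclic_group (G\<lparr>carrier := H\<rparr>)"
proof (cases "H = {\<one>}")
  case True
  have "generate G {\<one>} = {\<one>}" by (simp add: generate_one)
  then show ?thesis using cyclic_subgroup_iff[OF H(1)] True by auto
next
  case False
  then obtain x where x: "x \<in> H" "x \<noteq> \<one>" using subgroup.one_closed[OF H(1)] by blast
  have "generate G {x} \<subseteq> H" using generate_subgroup_incl[OF _ H(1)] x by simp
  moreover have "card H \<le> card (generate G {x})"
    using card_generate_ge[of x] x H subgroup.mem_carrier[OF H(1)] by fastforce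
  ultimately have "generate G {x} = H"
    using card_seteq[OF finite_subgroup[OF H(1)]] by blast
  then show ?thesis using cyclic_subgroup_iff[OF H(1)] x by blast
qed

lemma num_noncyclic_subgroups_eq_sum:
  "\<delta> G = (\<Sum>k = 2..n. card (noncyclic_subgroups (p ^ k)))"
proof -
  have "{H. subgroup H G \<and> \<not> cyclic_group (G\<lparr>carrier := H\<rparr>)}
      = (\<Union>k\<in>{2..n}. noncyclic_subgroups (p ^ k))" (is "?L = ?R")
  proof (intro subset_antisym subsetI)
    fix H assume "H \<in> ?L"
    then have H: "subgroup H G" "\<not> cyclic_group (G\<lparr>carrier := H\<rparr>)" by auto
    obtain k where k: "k \<le> n" "card H = p ^ k" using card_subgroup[OF H(1)] .
    have "\<not> k \<le> 1"
    proof
      assume "k \<le> 1"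
      then have "p ^ k \<le> p ^ 1" using p_gt_1 by (intro power_increasing) auto
      then show False using cyclic_of_order_le_p[OF H(1)] H(2) k(2) by simp
    qed
    then show "H \<in> ?R"
      using H k by (auto simp: noncyclic_subgroups_def subgroups_of_order_def intro!: bexI[of _ k])
  qed (auto simp: noncyclic_subgroups_def subgroups_of_order_def)
  moreover have "card ?R = (\<Sum>k = 2..n. card (noncyclic_subgroups (p ^ k)))"
  proof (rule card_UN_disjoint)
    show "\<forall>i\<in>{2..n}. finite (noncyclic_subgroups (p ^ i))"
      using finite_subgroups_of_order by (simp add: noncyclic_subgroups_def)
    show "\<forall>i\<in>{2..n}. \<forall>j\<in>{2..n}. i \<noteq> j \<longrightarrow>
        noncyclic_subgroups (p ^ i) \<inter> noncyclic_subgroups (p ^ j) = {}"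
      using p_gt_1 by (auto simp: noncyclic_subgroups_def subgroups_of_order_def)
  qed simp
  ultimately show ?thesis by (simp add: num_noncyclic_subgroups_def)
qed

lemma card_noncyclic_subgroups_le:
  "real (card (noncyclic_subgroups (p ^ k))) \<le> gauss_binomial p n k"
proof -
  have "card (noncyclic_subgroups (p ^ k)) \<le> card (subgroups_of_order G (p ^ k))"
    using finite_subgroups_of_order by (intro card_mono) (auto simp: noncyclic_subgroups_def)
  then show ?thesis
    using card_subgroups_of_order[OF finite_p_group_axioms, of k] by linarith
qed

text \<open>
  In a group of exponent \<open>p\<close> a cyclic subgroup has order at most \<open>p\<close>, so for \<open>k \<ge> 2\<close> all subgroups of
  order \<open>p ^ k\<close> are counted.
\<close>
lemma elementary_abelian_card_noncyclic_subgroups: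
  assumes ea: "elementary_abelian_group p G" and k: "k \<ge> 2"
  shows "real (card (noncyclic_subgroups (p ^ k))) = gauss_binomial p n k"
proof -
  have "\<not> cyclic_group (G\<lparr>carrier := H\<rparr>)" if H: "subgroup H G" "card H = p ^ k" for H
  proof
    assume "cyclic_group (G\<lparr>carrier := H\<rparr>)"
    then obtain x where x: "x \<in> H" "H = generate G {x}"
      using cyclic_subgroup_iff[OF H(1)] by blast
    then have xG: "x \<in> carrier G" using subgroup.mem_carrier[OF H(1)] by blast
    then have "ord x dvd p" using ea by (simp add: elementary_abelian_group_def pow_eq_id)
    then have "p ^ k \<le> p"
      using p_gt_1 H(2) x(2) generate_pow_card[OF xG] by (intro dvd_imp_le) auto
    moreover have "p ^ 1 < p ^ k" using p_gt_1 k by (intro power_strict_increasing) auto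
    ultimately show False by simp
  qed
  then have "noncyclic_subgroups (p ^ k) = subgroups_of_order G (p ^ k)"
    by (auto simp: noncyclic_subgroups_def subgroups_of_order_def)
  then show ?thesis
    using card_subgroups_of_order[OF finite_p_group_axioms, of k] ea by simp
qed

section \<open>Groups that attain the bound\<close>

lemma elementary_abelianI:
  assumes exp: "\<And>x. x \<in> carrier G \<Longrightarrow> x \<noteq> \<one> \<Longrightarrow> card (generate G {x}) = p"
    and comm: "\<And>x y. x \<in> carrier G \<Longrightarrow> y \<in> carrier G \<Longrightarrow> x \<noteq> \<one> \<Longrightarrow> y \<notin> generate G {x}
      \<Longrightarrow> x \<otimes> y = y \<otimes> x"
  shows "elementary_abelian_group p G"
proof -
  have "x \<otimes> y = y \<otimes> x" if xy: "x \<in> carrier G" "y \<in> carrier G" for x y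
  proof (cases "x = \<one>")
    case True
    then show ?thesis using xy by simp
  next
    case False
    show ?thesis
    proof (cases "y \<in> generate G {x}")
      case True
      then obtain i :: int where "y = x [^] i" using generate_pow[OF xy(1)] by blast
      then show ?thesis
        using xy int_pow_mult[of x 1 i] int_pow_mult[of x i 1] by (simp add: add.commute)
    next
      case False
      then show ?thesis using comm xy \<open>x \<noteq> \<one>\<close> by blast
    qed
  qed
  then have "comm_group G" by (intro group_comm_groupI) auto
  moreover have "x [^] p = \<one>" if "x \<in> carrier G" for x
    using that exp[of x] generate_pow_card[of x] pow_ord_eq_1[of x] by (cases "x = \<one>") auto
  ultimately show ?thesis by (auto simp: elementary_abelian_group_def)
qed

lemma elementary_abelian_if_order_le_p:
  assumes "n \<le> 1"
  shows "elementary_abelian_group p G"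
proof (rule elementary_abelianI)
  have le: "order G \<le> p"
    using power_increasing[of n 1 p] assms p_gt_1 order_eq by simp
  fix x assume x: "x \<in> carrier G" "x \<noteq> \<one>"
  have sub: "generate G {x} \<subseteq> carrier G" using x by (simp add: generate_incl)
  have ge: "p \<le> card (generate G {x})" using card_generate_ge x by blast
  show "card (generate G {x}) = p"
    using ge le card_mono[OF finite_carrier sub] by (simp add: order_def)
  have "generate G {x} = carrier G"
    using card_seteq[OF finite_carrier sub] ge le by (simp add: order_def)
  then show "x \<otimes> y = y \<otimes> x" if "y \<in> carrier G" "y \<notin> generate G {x}" for y
    using that by simp
qed

text \<open>
  The right-hand side of \<open>many\<close> counts the pairs \<open>(x, y)\<close> with \<open>x \<noteq> \<one>\<close> and \<open>y \<notin> \<langle>x\<rangle>\<close> that lie in a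
  noncyclic subgroup of order \<open>p ^ 2\<close>, without repetition since such a pair generates the subgroup.
  The left-hand side bounds the number of all such pairs in \<open>G\<close>: there are \<open>p ^ n - ord x\<close> choices of
  \<open>y\<close>, and \<open>ord x \<ge> p\<close>. The hypothesis therefore forces both that \<open>ord x = p\<close> for all \<open>x \<noteq> \<one>\<close> and that
  every pair lies in a noncyclic subgroup of order \<open>p ^ 2\<close>, where \<open>x\<close> and \<open>y\<close> commute.
\<close>
lemma elementary_abelian_if_many_noncyclic_subgroups:
  assumes n: "n \<ge> 2"
    and many: "(p ^ n - 1) * (p ^ n - p)
      \<le> card (noncyclic_subgroups (p ^ 2)) * ((p ^ 2 - 1) * (p ^ 2 - p))"
  shows "elementary_abelian_group p G"
proof -
  let ?N = "noncyclic_subgroups (p ^ 2)"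
  let ?gen = "\<lambda>x. generate G {x}"
  have N: "subgroup H G" "card H = p ^ 2" "\<not> cyclic_group (G\<lparr>carrier := H\<rparr>)" "finite H"
      "\<one> \<in> H" "H \<subseteq> carrier G" if "H \<in> ?N" for H
    using that
    by (auto simp: noncyclic_subgroups_def subgroups_of_order_def
        intro: finite_subgroup subgroup.one_closed subgroup.mem_carrier)
  have finN: "finite ?N"
    using finite_subgroups_of_order by (simp add: noncyclic_subgroups_def)
  have gen_sub: "?gen x \<subseteq> H" if "H \<in> ?N" "x \<in> H" for H x
    using generate_subgroup_incl[OF _ N(1)[OF that(1)]] that by simp
  have gen_card: "card (?gen x) = p" if H: "H \<in> ?N" and x: "x \<in> H" "x \<noteq> \<one>" for H x
  proof -
    have xG: "x \<in> carrier G" using N(6)[OF H] x by blast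
    have "?gen x \<noteq> H" using N(1,3)[OF H] x cyclic_subgroup_iff by blast
    then have "card (?gen x) < p ^ 2"
      using gen_sub[OF H x(1)] N(2,4)[OF H] psubset_card_mono[of H "?gen x"] by auto
    moreover obtain j where j: "card (?gen x) = p ^ j"
      using card_subgroup[of "?gen x"] generate_is_subgroup[of "{x}"] xG by auto
    ultimately have "j < 2" using p_gt_1 by simp
    then have "card (?gen x) \<le> p ^ 1"
      unfolding j using p_gt_1 by (intro power_increasing) auto
    then show ?thesis using card_generate_ge[OF xG x(2)] by simp
  qed
  define S where "S = (SIGMA H:?N. SIGMA x:H - {\<one>}. H - ?gen x)"
  define T where "T = (SIGMA x:carrier G - {\<one>}. carrier G - ?gen x)"
  have finT: "finite T" using finite_carrier by (auto simp: T_def)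
  have inj: "inj_on snd S"
  proof (rule inj_onI)
    fix u v assume uv: "u \<in> S" "v \<in> S" "snd u = snd v"
    obtain H x y K where u: "u = (H, x, y)" and v: "v = (K, x, y)"
      using uv(3) by (cases u, cases v) auto
    have HK: "H \<in> ?N" "K \<in> ?N" "x \<in> H" "x \<in> K" "x \<noteq> \<one>" "y \<in> H" "y \<in> K" "y \<notin> ?gen x"
      using uv u v by (auto simp: S_def)
    have "H = K"
      using subgroup_determined_by_maximal[of H 1 K "?gen x" y] HK
        N(1,2)[OF HK(1)] N(1,2)[OF HK(2)] gen_sub gen_card[OF HK(1,3,5)]
      by (simp add: numeral_2_eq_2)
    then show "u = v" by (simp add: u v)
  qed
  have sub: "snd ` S \<subseteq> T" using N(6) by (force simp: S_def T_def)
  have "card (SIGMA x:H - {\<one>}. H - ?gen x) = (p ^ 2 - 1) * (p ^ 2 - p)" if H: "H \<in> ?N" for H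
  proof -
    have "card (H - ?gen x) = p ^ 2 - p" if "x \<in> H - {\<one>}" for x
      using that gen_card[OF H] gen_sub[OF H] N(2,4)[OF H]
      by (subst card_Diff_subset) (auto intro: finite_subset)
    then show ?thesis using N(2,4,5)[OF H] by simp
  qed
  then have cardS: "card S = card ?N * ((p ^ 2 - 1) * (p ^ 2 - p))"
    unfolding S_def using finN N(4) by (subst card_SigmaI) auto
  have "card (carrier G - ?gen x) = p ^ n - card (?gen x)" if "x \<in> carrier G" for x
    using that finite_carrier order_eq generate_incl[of "{x}"]
    by (subst card_Diff_subset) (auto intro: finite_subset simp: order_def)
  then have cardT: "card T = (\<Sum>x\<in>carrier G - {\<one>}. p ^ n - card (?gen x))"
    unfolding T_def using finite_carrier by (subst card_SigmaI) auto
  have card_ne_1: "(\<Sum>x\<in>carrier G - {\<one>}. p ^ n - p) = (p ^ n - 1) * (p ^ n - p)"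
    using order_eq finite_carrier by (simp add: order_def)
  have T_le: "card T \<le> (p ^ n - 1) * (p ^ n - p)"
    unfolding cardT card_ne_1[symmetric]
    by (intro sum_mono diff_le_mono2) (auto intro: card_generate_ge)
  have ST: "card S = card T" "card T = (p ^ n - 1) * (p ^ n - p)"
    using card_inj_on_le[OF inj sub finT] T_le many cardS by auto
  have exp: "card (?gen x) = p" if x: "x \<in> carrier G" "x \<noteq> \<one>" for x
  proof (rule ccontr)
    assume "card (?gen x) \<noteq> p"
    then have gt: "p < card (?gen x)" using card_generate_ge[OF x] by simp
    have "card (?gen x) \<le> p ^ n"
      using card_mono[OF finite_carrier] generate_incl[of "{x}"] x order_eq by (simp add: order_def)
    with gt have "p ^ n - card (?gen x) < p ^ n - p" by simp
    then have "card T < (\<Sum>x\<in>carrier G - {\<one>}. p ^ n - p)"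
      unfolding cardT using x finite_carrier card_generate_ge
      by (intro sum_strict_mono_ex1) (auto intro!: diff_le_mono2)
    then show False using ST(2) card_ne_1 by simp
  qed
  have T_eq: "snd ` S = T"
    using sub ST(1) card_image[OF inj] finT by (intro card_subset_eq) auto
  show ?thesis
  proof (rule elementary_abelianI)
    fix x y assume xy: "x \<in> carrier G" "y \<in> carrier G" "x \<noteq> \<one>" "y \<notin> ?gen x"
    then have "(x, y) \<in> snd ` S" unfolding T_eq by (simp add: T_def)
    then obtain H where "(H, x, y) \<in> S" by auto
    then have H: "H \<in> ?N" "x \<in> H" "y \<in> H" by (auto simp: S_def)
    interpret K: finite_p_group "G\<lparr>carrier := H\<rparr>" p 2
      using subgroup_finite_p_group N(1,2)[OF H(1)] by blast
    have gen: "generate (G\<lparr>carrier := H\<rparr>) {z} = ?gen z" if "z \<in> H" for z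
      using generate_consistent[OF _ N(1)[OF H(1)], of "{z}"] that by simp
    have "y \<noteq> \<one>" using xy(4) generate.one[of G "{x}"] by auto
    then show "x \<otimes> y = y \<otimes> x"
      using K.commute_in_order_p_squared[of x y] H gen xy exp by simp
  qed (rule exp)
qed

end

theorem theorem1p1:
  fixes G :: "('a, 'b) monoid_scheme" and p n :: nat
  assumes "Factorial_Ring.prime p" and "group G" and "order G = p ^ n"
  shows "real (\<delta> G) \<le> (\<Sum>k = 2..n. gauss_binomial p n k)
    \<and> (real (\<delta> G) = (\<Sum>k = 2..n. gauss_binomial p n k)
        \<longleftrightarrow> elementary_abelian_group p G \<and> order G = p ^ n)"
proof -
  interpret finite_p_group G p n
    using assms by (simp add: finite_p_group_def finite_p_group_axioms_def)
  let ?N = "\<lambda>k. real (card (noncyclic_subgroups (p ^ k)))"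
  have delta: "real (\<delta> G) = (\<Sum>k = 2..n. ?N k)"
    by (simp add: num_noncyclic_subgroups_eq_sum)
  have le: "real (\<delta> G) \<le> (\<Sum>k = 2..n. gauss_binomial p n k)"
    unfolding delta by (intro sum_mono card_noncyclic_subgroups_le)
  have "elementary_abelian_group p G" if eq: "real (\<delta> G) = (\<Sum>k = 2..n. gauss_binomial p n k)"
  proof (cases "n \<le> 1")
    case True
    then show ?thesis by (rule elementary_abelian_if_order_le_p)
  next
    case False
    then have n: "n \<ge> 2" by simp
    have "?N 2 = gauss_binomial p n 2"
    proof (rule ccontr)
      assume "?N 2 \<noteq> gauss_binomial p n 2"
      then have "?N 2 < gauss_binomial p n 2"
        using card_noncyclic_subgroups_le[of 2] by linarith
      then have "real (\<delta> G) < (\<Sum>k = 2..n. gauss_binomial p n k)"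
        unfolding delta using n card_noncyclic_subgroups_le
        by (intro sum_strict_mono_ex1) auto
      then show False using eq by simp
    qed
    also have "\<dots> = (real p ^ n - 1) * (real p ^ (n - 1) - 1) / ((real p ^ 2 - 1) * (real p - 1))"
      by (simp add: gauss_binomial_def numeral_2_eq_2)
    \<comment> \<open>Clearing denominators and multiplying by \<open>p\<close> turns the value at \<open>k = 2\<close> into the count of pairs.\<close>
    finally have N2: "?N 2 = \<dots>" .
    have p: "real p > 1" using p_gt_1 by simp
    have "real p ^ 2 > 1" by (rule one_less_power[OF p]) simp
    then have "real p ^ 2 - 1 \<noteq> 0" "real p - 1 \<noteq> 0" using p by linarith+
    then have "?N 2 * ((real p ^ 2 - 1) * (real p - 1)) = (real p ^ n - 1) * (real p ^ (n - 1) - 1)"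
      unfolding N2 by (simp only: nonzero_eq_divide_eq[symmetric] mult_eq_0_iff de_Morgan_disj simp_thms)
    then have "?N 2 * ((real p ^ 2 - 1) * (real p - 1)) * real p
        = (real p ^ n - 1) * (real p ^ (n - 1) - 1) * real p"
      by simp
    moreover have "real p ^ n = real p ^ (n - 1) * real p"
      using n by (metis Suc_diff_1 order_less_le_trans pos2 power_Suc2)
    ultimately have "?N 2 * ((real p ^ 2 - 1) * (real p ^ 2 - real p))
        = (real p ^ n - 1) * (real p ^ n - real p)"
      by (simp add: algebra_simps power2_eq_square)
    moreover have "p \<le> p ^ m" "1 \<le> p ^ m" if "m \<ge> 2" for m
      using p_gt_1 that by (auto intro: self_le_power)
    ultimately have "real (card (noncyclic_subgroups (p ^ 2)) * ((p ^ 2 - 1) * (p ^ 2 - p)))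
        = real ((p ^ n - 1) * (p ^ n - p))"
      using n by (simp add: of_nat_diff)
    then have "card (noncyclic_subgroups (p ^ 2)) * ((p ^ 2 - 1) * (p ^ 2 - p))
        = (p ^ n - 1) * (p ^ n - p)"
      using of_nat_eq_iff by blast
    then show ?thesis
      using elementary_abelian_if_many_noncyclic_subgroups[OF n] by simp
  qed
  moreover have "real (\<delta> G) = (\<Sum>k = 2..n. gauss_binomial p n k)" if "elementary_abelian_group p G"
    unfolding delta using elementary_abelian_card_noncyclic_subgroups[OF that] by simp
  ultimately show ?thesis using le assms(3) by blast
qed

end
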